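(* Let $\mathcal{P}$ be a finite-dimensional Poisson algebra over an arbitrary field $\mathbb{F}$. Then $\mathcal{P}$ is nilpotent if and only if it is both associative nilpotent and Lie nilpotent.
   Context: A Poisson algebra $(\mathcal{P},\cdot,[\cdot,\cdot])$ over $\mathbb{F}$ is a vector space with two bilinear products such that $(\mathcal{P},\cdot)$ is a commutative associative algebra (not necessarily unital), $(\mathcal{P},[\cdot,\cdot])$ is a Lie algebra, and $[x\cdot y,z]=[x,z]\cdot y+x\cdot[y,z]$ for all $x,y,z$. For subspaces $X,Y$, $X\cdot Y$ and $[X,Y]$ denote the linear spans of all products. Put $\mathcal{P}^1=\mathcal{P}$ and $\mathcal{P}^{n+1}=\sum_{i=1}^{n}(\mathcal{P}^i\cdot\mathcal{P}^{n+1-i}+[\mathcal{P}^i,\mathcal{P}^{n+1-i}])$; $\mathcal{P}$ is nilpotent if $\mathcal{P}^m=0$ for some $m$. Put $\mathcal{P}_A^1=\mathcal{P}$, $\mathcal{P}_A^{n+1}=\mathcal{P}_A^n\cdot\mathcal{P}$, and $\mathcal{P}_L^1=\mathcal{P}$, $\mathcal{P}_L^{n+1}=[\mathcal{P}_L^n,\mathcal{P}]$; $\mathcal{P}$ is associative (respectively, Lie) nilpotent if $\mathcal{P}_A^m=0$ (respectively, $\mathcal{P}_L^m=0$) for some $m$. *)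

theory Defs
  imports "HOL.Vector_Spaces" "HOL-Library.Set_Algebras"
begin

locale bilinear_product = vector_space scale
  for scale :: "'f::field \<Rightarrow> 'a::ab_group_add \<Rightarrow> 'a" +
  fixes m :: "'a \<Rightarrow> 'a \<Rightarrow> 'a"
  assumes linear_left: "Vector_Spaces.linear scale scale (\<lambda>x. m x y)"
    and linear_right: "Vector_Spaces.linear scale scale (\<lambda>y. m x y)"

locale comm_assoc_algebra = vector_space scale + mult: bilinear_product scale mult
  for scale :: "'f::field \<Rightarrow> 'a::ab_group_add \<Rightarrow> 'a" and mult :: "'a \<Rightarrow> 'a \<Rightarrow> 'a" +
  assumes mult_commute: "mult x y = mult y x"
    and mult_assoc: "mult (mult x y) z = mult x (mult y z)"

text \<open>The bracket is required to be alternating, not merely antisymmetric, since the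
  field may have characteristic 2.\<close>

locale lie_algebra = vector_space scale + bracket: bilinear_product scale bracket
  for scale :: "'f::field \<Rightarrow> 'a::ab_group_add \<Rightarrow> 'a" and bracket :: "'a \<Rightarrow> 'a \<Rightarrow> 'a" +
  assumes bracket_self: "bracket x x = 0"
    and jacobi: "bracket x (bracket y z) + bracket y (bracket z x) + bracket z (bracket x y) = 0"

locale poisson_algebra =
  comm_assoc_algebra scale mult + lie_algebra scale bracket
  for scale :: "'f::field \<Rightarrow> 'a::ab_group_add \<Rightarrow> 'a"
    and mult :: "'a \<Rightarrow> 'a \<Rightarrow> 'a" (infixl \<open>\<cdot>\<close> 70)
    and bracket :: "'a \<Rightarrow> 'a \<Rightarrow> 'a" +
  assumes leibniz: "bracket (x \<cdot> y) z = bracket x z \<cdot> y + x \<cdot> bracket y z"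

context vector_space
begin

definition product_span :: "('b \<Rightarrow> 'b \<Rightarrow> 'b) \<Rightarrow> 'b set \<Rightarrow> 'b set \<Rightarrow> 'b set"
  where "product_span m X Y = span {m x y | x y. x \<in> X \<and> y \<in> Y}"

text \<open>All the series below are indexed from 1; the value at 0 is a dummy and is excluded
  in the definitions of nilpotency.\<close>

fun left_power :: "('b \<Rightarrow> 'b \<Rightarrow> 'b) \<Rightarrow> nat \<Rightarrow> 'b set"
  where
    "left_power m 0 = UNIV"
  | "left_power m (Suc 0) = UNIV"
  | "left_power m (Suc (Suc n)) = product_span m (left_power m (Suc n)) UNIV"

end

context poisson_algebra
begin

text \<open>Addition and summation of subspaces are the elementwise (Minkowski) operations
  on sets.\<close>

fun poisson_power :: "nat \<Rightarrow> 'a set"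
  where
    "poisson_power 0 = UNIV"
  | "poisson_power (Suc 0) = UNIV"
  | "poisson_power (Suc (Suc n)) =
      (\<Sum>i\<in>{1..Suc n}.
         product_span mult (poisson_power i) (poisson_power (Suc (Suc n) - i))
         + product_span bracket (poisson_power i) (poisson_power (Suc (Suc n) - i)))"

definition nilpotent :: bool
  where "nilpotent \<longleftrightarrow> (\<exists>m\<ge>1. poisson_power m = {0})"

definition associative_nilpotent :: bool
  where "associative_nilpotent \<longleftrightarrow> (\<exists>m\<ge>1. left_power mult m = {0})"

definition lie_nilpotent :: bool
  where "lie_nilpotent \<longleftrightarrow> (\<exists>m\<ge>1. left_power bracket m = {0})"

end

end

theory Submission
  imports Defs
begin

text \<open>
  Write \<open>P\<close> for the algebra, \<open>A k\<close> for the associative powers and \<open>L j\<close> for the Lie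
  powers. That nilpotency implies both other conditions is clear, because \<open>A n\<close> and \<open>L n\<close>
  lie in the Poisson power of index \<open>n\<close>.

  For the converse, the Leibniz rule makes every \<open>A k\<close> a Poisson ideal. Between \<open>A k\<close> and
  \<open>A (k + 1)\<close> lie the subspaces \<open>J j = A (k + 1) + (A k \<inter> L j)\<close>. Multiplication by \<open>P\<close>
  takes \<open>J j\<close> into \<open>A (k + 1)\<close>, and bracketing with \<open>P\<close> takes it into \<open>J (j + 1)\<close>, so either
  product with an arbitrary element moves one step down this chain. Since \<open>L m = 0\<close> for some
  \<open>m\<close>, the chain from \<open>A k\<close> arrives at \<open>A (k + 1)\<close> after finitely many steps; since some
  \<open>A k\<close> is \<open>0\<close>, finitely many such chains lead from \<open>P\<close> to \<open>0\<close>.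

  It remains to see that the Poisson powers, in which products are bracketed arbitrarily,
  descend along the chain as well (lemma \<open>poisson_power_descends\<close>). In a product of
  \<open>P\<^sup>i\<close> and \<open>P\<^sup>j\<close> with \<open>i + j\<close> large, one of the indices is at least half of the sum; the
  corresponding factor already lies in the given term of the chain, and the other factor pushes
  the product into the next term.
\<close>

section \<open>Subspaces spanned by products\<close>

context vector_space
begin

lemma product_in_product_span: "x \<in> X \<Longrightarrow> y \<in> Y \<Longrightarrow> m x y \<in> product_span m X Y"
  unfolding product_span_def by (rule span_base) blast

lemma product_span_least:
  assumes "subspace S" and "\<And>x y. x \<in> X \<Longrightarrow> y \<in> Y \<Longrightarrow> m x y \<in> S"
  shows "product_span m X Y \<subseteq> S"
  unfolding product_span_def using assms by (intro span_minimal) auto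

lemma zero_in_product_span: "0 \<in> product_span m X Y"
  unfolding product_span_def by (rule span_zero)

lemma subspace_left_power: "subspace (left_power m n)"
  by (cases "(m, n)" rule: left_power.cases) (simp_all add: product_span_def)

lemma product_in_left_power: "x \<in> left_power m n \<Longrightarrow> m x y \<in> left_power m (Suc n)"
  by (cases n) (auto intro: product_in_product_span)

lemma subspace_set_plus:
  assumes "subspace S" "subspace T"
  shows "subspace (S + T)"
proof -
  have "S + T = {x + y |x y. x \<in> S \<and> y \<in> T}"
    by (auto simp: set_plus_def)
  then show ?thesis
    using subspace_sums[OF assms] by simp
qed

lemma set_sum_subset_subspace:
  assumes "subspace S" and "finite I" and "\<And>i. i \<in> I \<Longrightarrow> X i \<subseteq> S"
  shows "(\<Sum>i\<in>I. X i) \<subseteq> S"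
  using assms(2,3)
proof (induction I rule: finite_induct)
  case empty
  then show ?case using subspace_0[OF assms(1)] by simp
next
  case (insert i I)
  then show ?case
    by (auto simp: set_plus_def intro!: subspace_add[OF assms(1)])
qed

end

lemma subset_set_sum:
  fixes X :: "'i \<Rightarrow> 'a::ab_group_add set"
  assumes "finite I" and "i \<in> I" and "\<And>j. j \<in> I \<Longrightarrow> 0 \<in> X j"
  shows "X i \<subseteq> (\<Sum>j\<in>I. X j)"
proof -
  have "0 \<in> (\<Sum>j\<in>I - {i}. X j)"
    using set_sum_alt[of "I - {i}" X] assms(1,3) by (auto intro!: exI[of _ "\<lambda>_. 0"])
  then show ?thesis
    unfolding sum.remove[OF assms(1,2)] using set_zero_plus2 add.commute by metis
qed

context bilinear_product
begin

lemma add_left: "m (x + x') y = m x y + m x' y"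
  using linear_left by (simp add: linear_iff)

lemma add_right: "m x (y + y') = m x y + m x y'"
  using linear_right by (simp add: linear_iff)

lemma zero_left: "m 0 y = 0"
  using add_left[of 0 0 y] by simp

lemma subspace_left_preimage:
  assumes "subspace S"
  shows "subspace {x. m x y \<in> S}"
  using linear_left[of y] assms by (auto simp: subspace_def linear_iff zero_left)

end

context poisson_algebra
begin

section \<open>The associative powers are Poisson ideals\<close>

lemma bracket_antisym: "bracket y x = - bracket x y"
proof -
  have "bracket (x + y) (x + y) = bracket x y + bracket y x"
    unfolding bracket.add_left bracket.add_right by (simp add: bracket_self)
  then have "bracket y x + bracket x y = 0"
    by (metis add.commute bracket_self)
  then show ?thesis
    by (simp only: eq_neg_iff_add_eq_0)
qed

lemma mult_left_power_ideal: "x \<in> left_power mult n \<Longrightarrow> x \<cdot> y \<in> left_power mult n"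
proof (cases n rule: poisson_power.cases)
  case (3 k)
  assume x: "x \<in> left_power mult n"
  \<comment> \<open>A generator of this power is a product \<open>u \<cdot> v\<close>, and \<open>(u \<cdot> v) \<cdot> y = u \<cdot> (v \<cdot> y)\<close>.\<close>
  have "product_span mult (left_power mult (Suc k)) UNIV \<subseteq> {x. x \<cdot> y \<in> left_power mult n}"
    using 3
    by (intro product_span_least mult.subspace_left_preimage subspace_left_power)
      (auto simp: mult_assoc intro: product_in_product_span)
  then show ?thesis using x 3 by auto
qed auto

text \<open>Bracketing a product differentiates one factor at a time, so it does not lower the number of
  factors.\<close>

lemma bracket_left_power_ideal: "x \<in> left_power mult n \<Longrightarrow> bracket x y \<in> left_power mult n"
proof (induction n arbitrary: x)
  case (Suc n)
  show ?case
  proof (cases n)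
    case (Suc k)
    have "u \<cdot> v \<in> {x. bracket x y \<in> left_power mult (Suc n)}" if "u \<in> left_power mult n" for u v
    proof -
      have "bracket u y \<cdot> v \<in> left_power mult (Suc n)" "u \<cdot> bracket v y \<in> left_power mult (Suc n)"
        using that Suc.IH by (auto intro: product_in_left_power)
      then show ?thesis
        by (simp only: mem_Collect_eq leibniz) (rule subspace_add[OF subspace_left_power])
    qed
    then have "product_span mult (left_power mult n) UNIV
        \<subseteq> {x. bracket x y \<in> left_power mult (Suc n)}"
      by (intro product_span_least bracket.subspace_left_preimage subspace_left_power)
    then show ?thesis using Suc.prems Suc by auto
  qed simp
qed simp

section \<open>Poisson powers\<close>

lemma product_spans_subset_poisson_power:
  assumes "i \<in> {1..Suc n}"
  shows "product_span mult (poisson_power i) (poisson_power (Suc (Suc n) - i))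
      \<subseteq> poisson_power (Suc (Suc n))"
    and "product_span bracket (poisson_power i) (poisson_power (Suc (Suc n) - i))
      \<subseteq> poisson_power (Suc (Suc n))"
proof -
  let ?X = "\<lambda>i. product_span mult (poisson_power i) (poisson_power (Suc (Suc n) - i))"
  let ?Y = "\<lambda>i. product_span bracket (poisson_power i) (poisson_power (Suc (Suc n) - i))"
  have "?X i + ?Y i \<subseteq> poisson_power (Suc (Suc n))"
    unfolding poisson_power.simps
    by (rule subset_set_sum[where X = "\<lambda>i. ?X i + ?Y i"])
      (use assms set_zero_plus2[OF zero_in_product_span, THEN subsetD, OF zero_in_product_span]
        in auto)
  moreover have "?X i \<subseteq> ?X i + ?Y i" "?Y i \<subseteq> ?X i + ?Y i"
    using set_zero_plus2 zero_in_product_span add.commute by metis+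
  ultimately show "?X i \<subseteq> poisson_power (Suc (Suc n))" "?Y i \<subseteq> poisson_power (Suc (Suc n))"
    by auto
qed

lemma zero_in_poisson_power: "0 \<in> poisson_power n"
proof (cases n rule: poisson_power.cases)
  case (3 k)
  then show ?thesis
    using product_spans_subset_poisson_power(1)[of 1 k] zero_in_product_span by auto
qed auto

lemma left_power_subset_poisson_power:
  assumes "m = mult \<or> m = bracket"
  shows "left_power m n \<subseteq> poisson_power n"
proof (induction n)
  case (Suc n)
  show ?case
  proof (cases n)
    case (Suc k)
    \<comment> \<open>The summand with \<open>i = n\<close> pairs the previous power with \<open>P\<^sup>1 = P\<close>.\<close>
    have "product_span m (poisson_power n) UNIV \<subseteq> poisson_power (Suc n)"
      using product_spans_subset_poisson_power[of n k] assms Suc by auto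
    moreover have "left_power m (Suc n) \<subseteq> product_span m (poisson_power n) UNIV"
      using Suc.IH Suc by (auto simp: product_span_def intro!: span_mono)
    ultimately show ?thesis by blast
  qed simp
qed simp

text \<open>If \<open>N\<close> works for \<open>I\<close>, then about \<open>2 * N\<close> works for \<open>J\<close>: two indices with such a sum cannot
  both be below \<open>N\<close>, so every product in the recursion has a factor in \<open>I\<close>. Commutativity and
  antisymmetry bring that factor to the left.\<close>

lemma poisson_power_descends:
  assumes J: "subspace J"
    and mult_J: "\<And>x y. x \<in> I \<Longrightarrow> x \<cdot> y \<in> J"
    and bracket_J: "\<And>x y. x \<in> I \<Longrightarrow> bracket x y \<in> J"
    and I: "\<exists>N. \<forall>n\<ge>N. poisson_power n \<subseteq> I"
  shows "\<exists>N. \<forall>n\<ge>N. poisson_power n \<subseteq> J"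
proof -
  obtain N where N: "\<And>n. n \<ge> N \<Longrightarrow> poisson_power n \<subseteq> I"
    using I by blast
  have "poisson_power n \<subseteq> J" if n: "n \<ge> 2 * N + 2" for n
  proof -
    obtain k where k: "n = Suc (Suc k)"
      using n by (cases n rule: poisson_power.cases) auto
    have prods: "x \<cdot> y \<in> J \<and> bracket x y \<in> J"
      if xy: "x \<in> poisson_power i" "y \<in> poisson_power (n - i)" for i x y
    proof -
      have "i \<ge> N \<or> n - i \<ge> N"
        using n by linarith
      then consider "x \<in> I" | "y \<in> I"
        using N xy by blast
      then show ?thesis
      proof cases
        case 2
        then have "y \<cdot> x \<in> J" "- bracket y x \<in> J"
          by (blast intro: mult_J bracket_J subspace_neg[OF J])+
        then show ?thesis
          using mult_commute[of x y] bracket_antisym[of y x] by simp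
      qed (auto intro: mult_J bracket_J)
    qed
    show ?thesis
      unfolding k poisson_power.simps
    proof (rule set_sum_subset_subspace[OF J])
      fix i
      have "product_span mult (poisson_power i) (poisson_power (Suc (Suc k) - i)) \<subseteq> J"
        and "product_span bracket (poisson_power i) (poisson_power (Suc (Suc k) - i)) \<subseteq> J"
        using prods[of _ i] unfolding k by (blast intro!: product_span_least[OF J])+
      then show "product_span mult (poisson_power i) (poisson_power (Suc (Suc k) - i))
          + product_span bracket (poisson_power i) (poisson_power (Suc (Suc k) - i)) \<subseteq> J"
        by (auto simp: set_plus_def intro!: subspace_add[OF J])
    qed simp
  qed
  then show ?thesis by blast
qed

section \<open>Descent through the associative powers\<close>

text \<open>An element of the ideal \<open>A k\<close> gains a factor when multiplied, and when bracketed it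
  stays in \<open>A k\<close> but moves down the Lie powers, of which only finitely many are nonzero. Adding
  \<open>A (k + 1)\<close> lets \<open>J (j + 1)\<close> receive both kinds of product with elements of \<open>J j\<close>.\<close>

lemma poisson_power_within_next_left_power:
  assumes lie: "left_power bracket m = {0}"
    and A: "\<exists>N. \<forall>n\<ge>N. poisson_power n \<subseteq> left_power mult k"
  shows "\<exists>N. \<forall>n\<ge>N. poisson_power n \<subseteq> left_power mult (Suc k)"
proof -
  define J where "J j = left_power mult (Suc k) + left_power mult k \<inter> left_power bracket j" for j
  have subspace_J: "subspace (J j)" for j
    unfolding J_def by (intro subspace_set_plus subspace_inter subspace_left_power)
  have mult_J: "x \<cdot> y \<in> J (Suc j)" if xJ: "x \<in> J j" for x y j
  proof -
    obtain a b where x: "x = a + b" and a: "a \<in> left_power mult (Suc k)"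
      and b: "b \<in> left_power mult k"
      using xJ unfolding J_def by (blast elim: set_plus_elim)
    have "x \<cdot> y \<in> left_power mult (Suc k)"
      unfolding x mult.add_left
      by (intro subspace_add subspace_left_power mult_left_power_ideal[OF a]
          product_in_left_power[OF b])
    then have "x \<cdot> y + 0 \<in> J (Suc j)"
      unfolding J_def by (intro set_plus_intro IntI subspace_0[OF subspace_left_power])
    then show ?thesis by simp
  qed
  have bracket_J: "bracket x y \<in> J (Suc j)" if xJ: "x \<in> J j" for x y j
  proof -
    obtain a b where x: "x = a + b" and a: "a \<in> left_power mult (Suc k)"
      and b: "b \<in> left_power mult k" "b \<in> left_power bracket j"
      using xJ unfolding J_def by (blast elim: set_plus_elim)
    show ?thesis
      unfolding x bracket.add_left J_def
      by (intro set_plus_intro IntI bracket_left_power_ideal[OF a]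
          bracket_left_power_ideal[OF b(1)] product_in_left_power[OF b(2)])
  qed
  have "\<exists>N. \<forall>n\<ge>N. poisson_power n \<subseteq> J j" for j
  proof (induction j)
    case 0
    have "left_power mult k \<subseteq> J 0"
      unfolding J_def using set_zero_plus2[OF subspace_0[OF subspace_left_power]] by simp
    then show ?case using A by blast
  next
    case (Suc j)
    show ?case
      by (rule poisson_power_descends[OF subspace_J mult_J bracket_J Suc.IH])
  qed
  moreover have "J m \<subseteq> left_power mult (Suc k)"
    unfolding J_def lie by (auto simp: set_plus_def)
  ultimately show ?thesis by blast
qed

theorem nilpotent_iff_associative_and_lie_nilpotent:
  "nilpotent \<longleftrightarrow> associative_nilpotent \<and> lie_nilpotent"
proof
  assume nilpotent
  then obtain m where "m \<ge> 1" "poisson_power m = {0}"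
    unfolding nilpotent_def by blast
  moreover have "0 \<in> left_power p m" for p
    by (rule subspace_0[OF subspace_left_power])
  ultimately have "left_power mult m = {0}" "left_power bracket m = {0}"
    using left_power_subset_poisson_power[of _ m] by blast+
  then show "associative_nilpotent \<and> lie_nilpotent"
    unfolding associative_nilpotent_def lie_nilpotent_def using \<open>m \<ge> 1\<close> by blast
next
  assume "associative_nilpotent \<and> lie_nilpotent"
  then obtain k m where assoc: "left_power mult k = {0}" and lie: "left_power bracket m = {0}"
    unfolding associative_nilpotent_def lie_nilpotent_def by blast
  \<comment> \<open>The induction starts at the default value \<open>UNIV\<close> of the associative power of index 0.\<close>
  have "\<exists>N. \<forall>n\<ge>N. poisson_power n \<subseteq> left_power mult k" for k
  proof (induction k)
    case (Suc k)
    then show ?case by (rule poisson_power_within_next_left_power[OF lie])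
  qed simp
  then obtain N where N: "\<forall>n\<ge>N. poisson_power n \<subseteq> {0}"
    using assoc by metis
  have "poisson_power (Suc N) \<subseteq> {0}"
    by (rule N[rule_format]) simp
  then have "poisson_power (Suc N) = {0}"
    using zero_in_poisson_power[of "Suc N"] by blast
  then show nilpotent
    unfolding nilpotent_def by (intro exI[of _ "Suc N"]) simp
qed

end

theorem proposition2p4:
  fixes scale :: "'f::field \<Rightarrow> 'a::ab_group_add \<Rightarrow> 'a"
    and mult bracket :: "'a \<Rightarrow> 'a \<Rightarrow> 'a"
  assumes "poisson_algebra scale mult bracket"
    and "\<exists>B. finite_dimensional_vector_space scale B"
  shows "poisson_algebra.nilpotent scale mult bracket \<longleftrightarrow>
    poisson_algebra.associative_nilpotent scale mult \<and>
    poisson_algebra.lie_nilpotent scale bracket"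
  by (rule poisson_algebra.nilpotent_iff_associative_and_lie_nilpotent[OF assms(1)])

end
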